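(* Let $n,m\in\mathbb{N}$ with $n,m\ge1$, let $\Sigma\in\mathbb{R}^{m\times m}$ be a covariance matrix, let $f:\mathbb{R}^n\to\mathbb{R}^m$ be an affine function, and for each $x\in\mathbb{R}^n$ let $S(x)\subseteq\mathbb{R}^m$ be a convex set such that $S(x)$ is linear on $x$. Define $h:\mathbb{R}^n\to[0,1]$ by $$h(x)=\int_{S(x)}\mathcal{N}(dz\mid f(x),\Sigma).$$ Then $h$ is log-concave on $\mathbb{R}^n$.
   Context: A parameter-dependent set $S(x)\subseteq\mathbb{R}^m$, $x\in\mathbb{R}^n$, is called linear on $x$ if there are a fixed set $S'\subseteq\mathbb{R}^m$ and a matrix $G\in\mathbb{R}^{m\times n}$ with $S(x)=S'+\{Gx\}$ (Minkowski sum) for all $x$. $\mathcal{N}(dz\mid\mu,\Sigma)$ denotes the (completed) Gaussian probability measure on $\mathbb{R}^m$ with mean $\mu$ and covariance matrix $\Sigma$, so $h(x)$ is the Gaussian measure of $S(x)$. A function $h:\mathbb{R}^n\to[0,\infty)$ is log-concave if $h(\lambda x_1+(1-\lambda)x_2)\ge h(x_1)^\lambda h(x_2)^{1-\lambda}$ for all $x_1,x_2\in\mathbb{R}^n$ and $\lambda\in(0,1)$. *)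

theory Defs
  imports "HOL-Probability.Probability"
begin

definition covariance_matrix :: "real^'m^'m \<Rightarrow> bool" where
  "covariance_matrix \<Sigma> \<longleftrightarrow> transpose \<Sigma> = \<Sigma> \<and> (\<forall>v. 0 \<le> v \<bullet> (\<Sigma> *v v))"

text \<open>
  The Gaussian measure is the law of \<open>\<mu> + A Z\<close>, where the components of \<open>Z\<close> are independent
  standard normal variables and \<open>A A\<^sup>T = \<Sigma>\<close>. Singular \<open>\<Sigma>\<close> is included; the measure then has no
  Lebesgue density. For a covariance matrix such an \<open>A\<close> exists, and the choice of \<open>A\<close> is immaterial:
  the lemma \<open>char_gaussian_measure\<close> below computes the characteristic function, which depends on
  \<open>\<mu>\<close> and \<open>\<Sigma>\<close> only.
\<close>

definition gaussian_measure :: "real^'m \<Rightarrow> real^'m^'m \<Rightarrow> (real^'m) measure" where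
  "gaussian_measure \<mu> \<Sigma> =
     distr (Pi\<^sub>M UNIV (\<lambda>_::'m. std_normal_distribution)) borel
       (\<lambda>\<omega>. \<mu> + (SOME A :: real^'m^'m. A ** transpose A = \<Sigma>) *v (\<chi> i. \<omega> i))"

definition affine_fun :: "(real^'n \<Rightarrow> real^'m) \<Rightarrow> bool" where
  "affine_fun f \<longleftrightarrow> (\<exists>(A :: real^'n^'m) b. \<forall>x. f x = A *v x + b)"

text \<open>The sum of sets is the Minkowski sum.\<close>

definition linear_on_parameter :: "(real^'n \<Rightarrow> (real^'m) set) \<Rightarrow> bool" where
  "linear_on_parameter S \<longleftrightarrow> (\<exists>S' (G :: real^'n^'m). \<forall>x. S x = S' + {G *v x})"

text \<open>Since \<open>0 powr l = 0\<close>, the inequality is the intended one also where \<open>h\<close> vanishes.\<close>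

definition log_concave_fun :: "(real^'n \<Rightarrow> real) \<Rightarrow> bool" where
  "log_concave_fun h \<longleftrightarrow>
     (\<forall>x. 0 \<le> h x) \<and>
     (\<forall>x1 x2. \<forall>l\<in>{0<..<1}.
        h (l *\<^sub>R x1 + (1 - l) *\<^sub>R x2) \<ge> h x1 powr l * h x2 powr (1 - l))"

lemma covariance_matrix_sym:
  assumes "covariance_matrix \<Sigma>" shows "\<Sigma>$i$j = \<Sigma>$j$i"
  using assms unfolding covariance_matrix_def by (metis transpose_def vec_lambda_beta)

lemma covariance_matrix_quadratic_shift:
  assumes "covariance_matrix \<Sigma>"
  shows "0 \<le> v \<bullet> (\<Sigma> *v v) + 2 * s * (\<Sigma> *v v)$k + s\<^sup>2 * \<Sigma>$k$k"
proof -
  let ?w = "v + s *\<^sub>R axis k 1"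
  have sym: "v \<bullet> (\<Sigma> *v axis k 1) = (\<Sigma> *v v)$k"
    using assms unfolding covariance_matrix_def
    by (metis cart_eq_inner_axis dot_lmul_matrix inner_commute transpose_matrix_vector)
  have diag: "axis k 1 \<bullet> (\<Sigma> *v axis k 1) = \<Sigma>$k$k"
    by (simp add: matrix_vector_mult_basis column_def inner_axis')
  have left: "axis k 1 \<bullet> (\<Sigma> *v v) = (\<Sigma> *v v)$k"
    by (simp add: inner_axis')
  have "?w \<bullet> (\<Sigma> *v ?w) = v \<bullet> (\<Sigma> *v v) + 2 * s * (\<Sigma> *v v)$k + s\<^sup>2 * \<Sigma>$k$k"
    by (simp add: matrix_vector_right_distrib matrix_vector_mult_scaleR inner_add_left
        inner_add_right sym diag left power2_eq_square algebra_simps)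
  then show ?thesis
    using assms unfolding covariance_matrix_def by metis
qed

lemma covariance_matrix_diag:
  assumes "covariance_matrix \<Sigma>" shows "0 \<le> \<Sigma>$k$k"
  using covariance_matrix_quadratic_shift[OF assms, of 0 1 k] by simp

lemma covariance_matrix_zero_diag:
  assumes "covariance_matrix \<Sigma>" "\<Sigma>$i$i = 0" shows "\<Sigma>$i$j = 0"
proof (rule ccontr)
  assume nz: "\<Sigma>$i$j \<noteq> 0"
  have quad: "axis j 1 \<bullet> (\<Sigma> *v axis j 1) = \<Sigma>$j$j"
    by (simp add: matrix_vector_mult_basis column_def inner_axis')
  have comp: "(\<Sigma> *v axis j 1)$i = \<Sigma>$i$j"
    by (simp add: matrix_vector_mult_basis column_def)
  have "0 \<le> \<Sigma>$j$j + 2 * s * \<Sigma>$i$j" for s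
    using covariance_matrix_quadratic_shift[OF assms(1), of "axis j 1" s i] assms(2) quad comp
    by simp
  from this[of "- (\<Sigma>$j$j + 1) / (2 * \<Sigma>$i$j)"] show False
    using nz by (simp add: field_simps)
qed

lemma covariance_matrix_factor_aux:
  fixes \<Sigma> :: "real^'m^'m"
  assumes "finite I" "covariance_matrix \<Sigma>" "\<And>i. i \<notin> I \<Longrightarrow> \<Sigma>$i$i = 0"
  shows "\<exists>A :: real^'m^'m. A ** transpose A = \<Sigma> \<and> (\<forall>i j. j \<notin> I \<longrightarrow> A$i$j = 0)"
  using assms
proof (induction I arbitrary: \<Sigma> rule: finite_induct)
  case empty
  then have "\<Sigma>$i$j = 0" for i j
    using covariance_matrix_zero_diag[of \<Sigma> i j] by blast
  then have "\<Sigma> = 0" by (simp add: vec_eq_iff)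
  then show ?case by (intro exI[of _ 0]) simp
next
  case (insert k I)
  note cov = insert.prems(1)
  show ?case
  proof (cases "\<Sigma>$k$k = 0")
    case True
    then have "\<And>i. i \<notin> I \<Longrightarrow> \<Sigma>$i$i = 0" using insert.prems(2) by (metis insertE)
    then obtain A :: "real^'m^'m" where "A ** transpose A = \<Sigma>" "\<forall>i j. j \<notin> I \<longrightarrow> A$i$j = 0"
      using insert.IH[OF cov] by blast
    then show ?thesis by (intro exI[of _ A]) auto
  next
    case False
    define d where "d = \<Sigma>$k$k"
    have d: "d > 0" using False covariance_matrix_diag[OF cov, of k] by (simp add: d_def)
    define T :: "real^'m^'m" where "T = (\<chi> i j. \<Sigma>$i$j - \<Sigma>$i$k * \<Sigma>$j$k / d)"
    have Tv: "v \<bullet> (T *v v) = v \<bullet> (\<Sigma> *v v) - ((\<Sigma> *v v)$k)\<^sup>2 / d" for v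
    proof -
      have *: "(\<Sigma> *v v)$k = (\<Sum>j\<in>UNIV. \<Sigma>$j$k * v$j)"
        unfolding matrix_vector_mult_def vec_lambda_beta
        by (intro sum.cong refl) (metis covariance_matrix_sym[OF cov])
      have "(T *v v)$i = (\<Sigma> *v v)$i - \<Sigma>$i$k * (\<Sigma> *v v)$k / d" for i
        unfolding * by (simp add: matrix_vector_mult_def T_def algebra_simps sum_subtractf
            sum_distrib_left sum_divide_distrib)
      then have "v \<bullet> (T *v v)
          = (\<Sum>i\<in>UNIV. v$i * ((\<Sigma> *v v)$i - \<Sigma>$i$k * (\<Sigma> *v v)$k / d))"
        by (simp add: inner_vec_def)
      also have "\<dots>
          = (\<Sum>i\<in>UNIV. v$i * (\<Sigma> *v v)$i) - (\<Sum>i\<in>UNIV. \<Sigma>$i$k * v$i) * (\<Sigma> *v v)$k / d"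
        by (simp add: algebra_simps sum_subtractf sum_distrib_left sum_divide_distrib)
      finally show ?thesis
        unfolding *[symmetric] by (simp add: inner_vec_def power2_eq_square)
    qed
    have covT: "covariance_matrix T"
      unfolding covariance_matrix_def
    proof (intro conjI allI)
      show "transpose T = T"
        using covariance_matrix_sym[OF cov] by (simp add: vec_eq_iff transpose_def T_def)
      fix v
      have "0 \<le> v \<bullet> (\<Sigma> *v v) + 2 * (- ((\<Sigma> *v v)$k / d)) * (\<Sigma> *v v)$k
               + (- ((\<Sigma> *v v)$k / d))\<^sup>2 * \<Sigma>$k$k"
        by (rule covariance_matrix_quadratic_shift[OF cov])
      then show "0 \<le> v \<bullet> (T *v v)"
        unfolding Tv using d by (simp add: d_def[symmetric] power2_eq_square field_simps)
    qed
    have "T$i$i = 0" if "i \<notin> I" for i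
    proof (cases "i = k")
      case True
      then show ?thesis using d by (simp add: T_def d_def)
    next
      case False
      then have "T$i$i \<le> 0"
        using that insert.prems(2)[of i] d by (simp add: T_def)
      then show ?thesis using covariance_matrix_diag[OF covT, of i] by simp
    qed
    then obtain B :: "real^'m^'m" where B: "B ** transpose B = T" "\<forall>i j. j \<notin> I \<longrightarrow> B$i$j = 0"
      using insert.IH[OF covT] by blast
    define A :: "real^'m^'m" where "A = (\<chi> i j. if j = k then \<Sigma>$i$k / sqrt d else B$i$j)"
    have "(A ** transpose A)$i$j = \<Sigma>$i$j" for i j
    proof -
      have "(A ** transpose A)$i$j = (\<Sum>l\<in>UNIV. A$i$l * A$j$l)"
        by (simp add: matrix_matrix_mult_def transpose_def)
      also have "\<dots> = (\<Sum>l\<in>UNIV. B$i$l * B$j$l + (if l = k then \<Sigma>$i$k * \<Sigma>$j$k / d else 0))"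
        using B(2) insert.hyps(2) d by (intro sum.cong) (auto simp: A_def)
      also have "\<dots> = (B ** transpose B)$i$j + \<Sigma>$i$k * \<Sigma>$j$k / d"
        by (simp add: sum.distrib matrix_matrix_mult_def transpose_def)
      also have "\<dots> = \<Sigma>$i$j" by (simp add: B(1) T_def)
      finally show ?thesis .
    qed
    moreover have "\<forall>i j. j \<notin> insert k I \<longrightarrow> A$i$j = 0"
      using B(2) by (simp add: A_def)
    ultimately show ?thesis by (intro exI[of _ A]) (simp add: vec_eq_iff)
  qed
qed

lemma covariance_matrix_factor:
  fixes \<Sigma> :: "real^'m^'m"
  assumes "covariance_matrix \<Sigma>"
  shows "\<exists>A :: real^'m^'m. A ** transpose A = \<Sigma>"
  using covariance_matrix_factor_aux[of UNIV \<Sigma>] assms by auto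

lemma prob_space_std_normal_PiM:
  "prob_space (Pi\<^sub>M UNIV (\<lambda>_::'m::finite. std_normal_distribution))"
proof (rule prob_space_PiM)
  show "prob_space std_normal_distribution"
    using real_dist_normal_dist by (simp add: real_distribution_def)
qed

lemma measurable_gaussian_map:
  "(\<lambda>\<omega>. \<mu> + A *v (\<chi> i. \<omega> i))
     \<in> borel_measurable (Pi\<^sub>M UNIV (\<lambda>_::'m::finite. std_normal_distribution))"
proof -
  have "(\<lambda>\<omega>::'m \<Rightarrow> real. \<chi> i. \<omega> i) = (\<lambda>\<omega>. \<Sum>i\<in>UNIV. \<omega> i *\<^sub>R axis i 1)"
    by (auto simp: vec_eq_iff axis_def if_distrib cong: if_cong)
  moreover have "(\<lambda>\<omega>. \<Sum>i\<in>UNIV. \<omega> i *\<^sub>R (axis i 1 :: real^'m))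
      \<in> borel_measurable (Pi\<^sub>M UNIV (\<lambda>_::'m::finite. std_normal_distribution))"
  proof (intro borel_measurable_sum borel_measurable_scaleR borel_measurable_const)
    fix i :: 'm
    have "(\<lambda>\<omega>. \<omega> i) \<in> measurable (Pi\<^sub>M UNIV (\<lambda>_::'m::finite. std_normal_distribution))
            std_normal_distribution"
      by (rule measurable_component_singleton) simp
    then show "(\<lambda>\<omega>. \<omega> i)
      \<in> borel_measurable (Pi\<^sub>M UNIV (\<lambda>_::'m::finite. std_normal_distribution))"
      by (simp add: measurable_def)
  qed
  ultimately have "(\<lambda>\<omega>. \<chi> i. \<omega> i)
      \<in> borel_measurable (Pi\<^sub>M UNIV (\<lambda>_::'m::finite. std_normal_distribution))"
    by simp
  moreover have "(\<lambda>z. \<mu> + A *v z) \<in> borel_measurable borel"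
    by (intro borel_measurable_continuous_onI continuous_intros
        matrix_vector_mult_linear_continuous_on)
  ultimately show ?thesis by (rule measurable_compose)
qed

lemma prob_space_gaussian_measure: "prob_space (gaussian_measure \<mu> \<Sigma>)"
  unfolding gaussian_measure_def
  by (rule prob_space.prob_space_distr[OF prob_space_std_normal_PiM measurable_gaussian_map])

lemma char_gaussian_measure:
  fixes \<Sigma> :: "real^'m^'m"
  assumes "covariance_matrix \<Sigma>"
  shows "(CLINT z|gaussian_measure \<mu> \<Sigma>. iexp (t \<bullet> z))
           = iexp (t \<bullet> \<mu>) * complex_of_real (exp (- (t \<bullet> (\<Sigma> *v t)) / 2))"
proof -
  define A :: "real^'m^'m" where "A = (SOME A. A ** transpose A = \<Sigma>)"
  have A: "A ** transpose A = \<Sigma>"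
    unfolding A_def using covariance_matrix_factor[OF assms] by (rule someI_ex)
  define s where "s = transpose A *v t"
  interpret N: prob_space std_normal_distribution
    using real_dist_normal_dist by (simp add: real_distribution_def)
  interpret product_sigma_finite "\<lambda>_::'m. std_normal_distribution"
    by standard
  have st: "t \<bullet> (A *v z) = s \<bullet> z" for z
    by (simp add: s_def dot_lmul_matrix transpose_matrix_vector)
  have ss: "s \<bullet> s = t \<bullet> (\<Sigma> *v t)"
    using st[of s] A by (metis s_def matrix_vector_mul_assoc)
  have "(CLINT z|gaussian_measure \<mu> \<Sigma>. iexp (t \<bullet> z))
      = (CLINT \<omega>|Pi\<^sub>M UNIV (\<lambda>_::'m. std_normal_distribution). iexp (t \<bullet> (\<mu> + A *v (\<chi> i. \<omega> i))))"
    unfolding gaussian_measure_def A_def[symmetric]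
    by (rule integral_distr[OF measurable_gaussian_map]) measurable
  also have "\<dots> = (CLINT \<omega>|Pi\<^sub>M UNIV (\<lambda>_::'m. std_normal_distribution).
                  iexp (t \<bullet> \<mu>) * (\<Prod>i\<in>UNIV. iexp (s$i * \<omega> i)))"
  proof (intro Bochner_Integration.integral_cong refl)
    fix \<omega> :: "'m \<Rightarrow> real"
    have "s \<bullet> (\<chi> i. \<omega> i) = (\<Sum>i\<in>UNIV. s$i * \<omega> i)"
      by (simp add: inner_vec_def)
    then show "iexp (t \<bullet> (\<mu> + A *v (\<chi> i. \<omega> i)))
        = iexp (t \<bullet> \<mu>) * (\<Prod>i\<in>UNIV. iexp (s$i * \<omega> i))"
      by (simp only: inner_add_right st)
         (simp add: exp_add distrib_left sum_distrib_left exp_sum)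
  qed
  also have "\<dots> = iexp (t \<bullet> \<mu>) * (CLINT \<omega>|Pi\<^sub>M UNIV (\<lambda>_::'m. std_normal_distribution).
                  (\<Prod>i\<in>UNIV. iexp (s$i * \<omega> i)))"
    by simp
  also have "(CLINT \<omega>|Pi\<^sub>M UNIV (\<lambda>_::'m. std_normal_distribution). (\<Prod>i\<in>UNIV. iexp (s$i * \<omega> i)))
      = (\<Prod>i\<in>UNIV. CLINT x|std_normal_distribution. iexp (s$i * x))"
  proof (rule product_integral_prod)
    fix i
    show "integrable std_normal_distribution (\<lambda>x. iexp (s$i * x))"
      by (rule N.integrable_const_bound[of _ 1]) auto
  qed simp
  also have "\<dots> = (\<Prod>i\<in>UNIV. complex_of_real (exp (- ((s$i)\<^sup>2) / 2)))"
    using char_std_normal_distribution by (simp add: char_def fun_eq_iff)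
  also have "\<dots> = complex_of_real (exp (- (s \<bullet> s) / 2))"
    by (simp add: inner_vec_def exp_sum[symmetric] sum_negf sum_divide_distrib power2_eq_square
        flip: of_real_prod)
  finally show ?thesis by (simp only: ss)
qed

end

theory Submission
  imports Defs
begin

text \<open>
  Write the Gaussian law as the image of the standard Gaussian law \<open>\<gamma>\<close> under \<open>z \<mapsto> f x + A z\<close>. Then
  \<open>h x = \<gamma> (T x)\<close> for convex sets \<open>T x\<close> with \<open>l T x + (1 - l) T y \<subseteq> T (l x + (1 - l) y)\<close>, and the claim is
  the Prekopa-Leindler inequality for indicator functions under \<open>\<gamma>\<close>. That inequality follows by induction
  on the dimension from the case of the real line, where it is the Brunn-Minkowski inequality for
  superlevel sets, and it passes from Lebesgue measure to \<open>\<gamma>\<close> since the normal density is log-concave.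
  Convex sets need not be Borel; the boundary of \<open>T x\<close> is Lebesgue null, so \<open>T x\<close> may be replaced by its
  interior or its closure.
\<close>

section \<open>The Brunn-Minkowski inequality on the real line\<close>

text \<open>\<open>inner_regular\<close> speaks of finite measures, so it is applied to
  \<open>lborel\<close> restricted to \<open>A\<close>, written as a density; the two measures agree
  on Borel subsets of \<open>A\<close>. If \<open>e\<close> exceeds the measure of \<open>A\<close>,
  the empty set does, and the separate case keeps negative numbers out of
  \<open>ennreal\<close>.\<close>

lemma fmeasurable_lborel_inner_compact:
  fixes A :: "'a::euclidean_space set"
  assumes A: "A \<in> fmeasurable lborel" and "e > 0"
  obtains K where "compact K" "K \<subseteq> A" "measure lborel A - e < measure lborel K"
proof -
  have [measurable]: "A \<in> sets borel" and fin: "emeasure lborel A < \<infinity>"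
    using A by (auto simp: fmeasurable_def)
  let ?M = "density lborel (indicator A)"
  have M: "emeasure ?M K = emeasure lborel K" if "K \<in> sets borel" "K \<subseteq> A" for K
    using that by (simp add: emeasure_density flip: indicator_inter_arith)
       (simp add: Int_absorb1)
  have fM: "emeasure ?M (space ?M) \<noteq> \<infinity>"
    using fin by (simp add: emeasure_density)
  have *: "emeasure lborel A = (SUP K\<in>{K. K \<subseteq> A \<and> compact K}. emeasure ?M K)"
    using inner_regular[OF _ fM, of A] M[of A] by simp
  show thesis
  proof (cases "measure lborel A - e < 0")
    case True
    then show thesis using that[of "{}"] by simp
  next
    case False
    have "ennreal (measure lborel A - e) < emeasure lborel A"
      using fin False \<open>e > 0\<close> by (subst emeasure_eq_ennreal_measure) (auto simp: ennreal_lessI)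
    then obtain K where K: "K \<subseteq> A" "compact K" "ennreal (measure lborel A - e) < emeasure ?M K"
      unfolding * less_SUP_iff by auto
    have "emeasure lborel K < \<infinity>"
      using emeasure_mono[of K A lborel] K fin by (auto intro: le_less_trans)
    then have "emeasure lborel K = ennreal (measure lborel K)"
      by (subst emeasure_eq_ennreal_measure) auto
    with K False have "measure lborel A - e < measure lborel K"
      using M[of K] by (simp add: borel_compact ennreal_less_iff)
    then show thesis using that K by blast
  qed
qed

lemma measure_lborel_image_affine:
  fixes K :: "real set"
  assumes "compact K"
  shows "measure lborel ((\<lambda>x. c + m * x) ` K) = \<bar>m\<bar> * measure lborel K"
proof -
  have "compact ((\<lambda>x. c + m * x) ` K)"
    by (intro compact_continuous_image continuous_intros assms)
  then have "measure lborel ((\<lambda>x. c + m * x) ` K) = measure lebesgue ((\<lambda>x. c + m * x) ` K)"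
    by (simp add: borel_compact)
  also have "\<dots> = measure lebesgue ((\<lambda>x. m *\<^sub>R x + c) ` K)"
    by (simp add: add.commute)
  also have "\<dots> = \<bar>m\<bar> * measure lebesgue K"
    by (subst measure_lebesgue_affine) simp
  finally show ?thesis using assms by (simp add: borel_compact)
qed

lemma fmeasurable_lborel_compact: "compact K \<Longrightarrow> K \<in> fmeasurable lborel"
  using emeasure_bounded_finite[OF compact_imp_bounded, of K]
  by (simp add: fmeasurable_def borel_compact)

text \<open>Two translates, one of \<open>l K\<close> and one of \<open>(1 - l) L\<close>, fit into \<open>l K + (1 - l) L\<close> side by side:
  they meet only at the image of \<open>(max K, min L)\<close>.\<close>

lemma brunn_minkowski_real_compact:
  fixes K L C :: "real set"
  assumes K: "compact K" "K \<noteq> {}" and L: "compact L" "L \<noteq> {}" and C: "C \<in> fmeasurable lborel"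
    and l: "0 \<le> l" "l \<le> 1"
    and sub: "\<And>a b. a \<in> K \<Longrightarrow> b \<in> L \<Longrightarrow> l * a + (1 - l) * b \<in> C"
  shows "l * measure lborel K + (1 - l) * measure lborel L \<le> measure lborel C"
proof -
  obtain a where a: "a \<in> K" "\<And>x. x \<in> K \<Longrightarrow> x \<le> a"
    using compact_attains_sup[OF K] by blast
  obtain b where b: "b \<in> L" "\<And>x. x \<in> L \<Longrightarrow> b \<le> x"
    using compact_attains_inf[OF L] by blast
  let ?K = "(\<lambda>x. (1 - l) * b + l * x) ` K" and ?L = "(\<lambda>x. l * a + (1 - l) * x) ` L"
  have fK: "?K \<in> fmeasurable lborel" and fL: "?L \<in> fmeasurable lborel"
    by (intro fmeasurable_lborel_compact compact_continuous_image continuous_intros K L)+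
  have "?K \<inter> ?L \<subseteq> {l * a + (1 - l) * b}"
  proof
    fix z assume "z \<in> ?K \<inter> ?L"
    then obtain x y where "x \<in> K" "y \<in> L" "z = (1 - l) * b + l * x" "z = l * a + (1 - l) * y"
      by blast
    moreover from this have "l * x \<le> l * a" "(1 - l) * b \<le> (1 - l) * y"
      using a b l by (auto intro: mult_left_mono)
    ultimately have "z = l * a + (1 - l) * b" by linarith
    then show "z \<in> {l * a + (1 - l) * b}" by simp
  qed
  then have "emeasure lborel (?K \<inter> ?L) \<le> emeasure lborel {l * a + (1 - l) * b}"
    by (intro emeasure_mono) auto
  then have 0: "measure lborel (?K \<inter> ?L) = 0"
    by (simp add: measure_def)
  have "l * measure lborel K + (1 - l) * measure lborel L = measure lborel ?K + measure lborel ?L"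
    using l K L by (simp add: measure_lborel_image_affine)
  also have "\<dots> = measure lborel (?K \<union> ?L)"
    using measure_Un3[OF fK fL] 0 by simp
  also have "\<dots> \<le> measure lborel C"
  proof (rule measure_mono_fmeasurable)
    show "?K \<union> ?L \<subseteq> C"
      using sub[OF a(1)] sub[OF _ b(1)] by (auto simp: add.commute)
    show "?K \<union> ?L \<in> sets lborel"
      by (intro sets.Un fmeasurableD fK fL)
  qed (fact C)
  finally show ?thesis .
qed

text \<open>Inner regularity reduces this to compact sets; the two errors \<open>e\<close> carry
  weights \<open>l\<close> and \<open>1 - l\<close> and so add up to \<open>e\<close>. A measurable
  \<open>C\<close> containing the combinations replaces the Minkowski sum, which need not be
  Borel.\<close>

lemma brunn_minkowski_real:
  fixes A B C :: "real set"
  assumes A: "A \<in> fmeasurable lborel" "A \<noteq> {}" and B: "B \<in> fmeasurable lborel" "B \<noteq> {}"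
    and C: "C \<in> fmeasurable lborel" and l: "0 \<le> l" "l \<le> 1"
    and sub: "\<And>a b. a \<in> A \<Longrightarrow> b \<in> B \<Longrightarrow> l * a + (1 - l) * b \<in> C"
  shows "l * measure lborel A + (1 - l) * measure lborel B \<le> measure lborel C"
proof (rule field_le_epsilon)
  fix e :: real assume "e > 0"
  \<comment> \<open>The compact case uses the extreme points of both sets, so a point of
    \<open>D\<close> is inserted in case the approximating set is empty.\<close>
  have inner: "\<exists>K. compact K \<and> K \<noteq> {} \<and> K \<subseteq> D \<and> measure lborel D - e \<le> measure lborel K"
    if D: "D \<in> fmeasurable lborel" "D \<noteq> {}" for D :: "real set"
  proof -
    obtain K where K: "compact K" "K \<subseteq> D" "measure lborel D - e < measure lborel K"
      using fmeasurable_lborel_inner_compact[OF D(1) \<open>e > 0\<close>] by blast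
    obtain d where "d \<in> D" using D by blast
    have "measure lborel K \<le> measure lborel (insert d K)"
      using K by (intro measure_mono_fmeasurable fmeasurable_lborel_compact compact_insert)
        (auto simp: borel_compact)
    with K \<open>d \<in> D\<close> show ?thesis by (intro exI[of _ "insert d K"]) auto
  qed
  obtain K where K: "compact K" "K \<noteq> {}" "K \<subseteq> A" "measure lborel A - e \<le> measure lborel K"
    using inner[OF A] by blast
  obtain L where L: "compact L" "L \<noteq> {}" "L \<subseteq> B" "measure lborel B - e \<le> measure lborel L"
    using inner[OF B] by blast
  have "l * (measure lborel A - e) + (1 - l) * (measure lborel B - e)
      \<le> l * measure lborel K + (1 - l) * measure lborel L"
    using K L l by (intro add_mono mult_left_mono) auto
  also have "\<dots> \<le> measure lborel C"
    using K L by (intro brunn_minkowski_real_compact C l sub) auto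
  finally show "l * measure lborel A + (1 - l) * measure lborel B \<le> measure lborel C + e"
    by (simp add: algebra_simps)
qed

section \<open>The Prekopa-Leindler inequality for Lebesgue measure on the real line\<close>

text \<open>The value \<open>f x\<close> is the length of the interval from 0 to \<open>f x\<close>;
  Tonelli's theorem then exchanges the integrals over \<open>x\<close> and \<open>t\<close>.\<close>

lemma nn_integral_layer_cake:
  fixes f :: "'a \<Rightarrow> real"
  assumes "sigma_finite_measure M" and [measurable]: "f \<in> borel_measurable M"
    and nonneg: "\<And>x. 0 \<le> f x"
  shows "(\<integral>\<^sup>+x. ennreal (f x) \<partial>M)
    = (\<integral>\<^sup>+t. indicator {0<..} t * emeasure M {x\<in>space M. t < f x} \<partial>lborel)"
proof -
  interpret sigma_finite_measure M by fact
  interpret pair_sigma_finite M "lborel :: real measure" ..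
  have "(\<integral>\<^sup>+x. ennreal (f x) \<partial>M) = (\<integral>\<^sup>+x. (\<integral>\<^sup>+t. indicator {0<..<f x} t \<partial>lborel) \<partial>M)"
    using nonneg by (intro nn_integral_cong) simp
  also have "\<dots> = (\<integral>\<^sup>+x. (\<integral>\<^sup>+t. indicator {0<..} t * indicator {x. t < f x} x \<partial>lborel) \<partial>M)"
    by (intro nn_integral_cong) (auto split: split_indicator)
  also have "\<dots> = (\<integral>\<^sup>+t. (\<integral>\<^sup>+x. indicator {0<..} t * indicator {x. t < f x} x \<partial>M) \<partial>lborel)"
    by (intro Fubini'[symmetric]) measurable
  also have "\<dots> = (\<integral>\<^sup>+t. indicator {0<..} t * emeasure M {x\<in>space M. t < f x} \<partial>lborel)"
  proof (intro nn_integral_cong)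
    fix t :: real
    have "(\<integral>\<^sup>+x. indicator {0<..} t * indicator {x. t < f x} x \<partial>M)
        = (\<integral>\<^sup>+x. indicator {0<..} t * indicator {x\<in>space M. t < f x} x \<partial>M)"
      by (intro nn_integral_cong) (auto split: split_indicator)
    then show "(\<integral>\<^sup>+x. indicator {0<..} t * indicator {x. t < f x} x \<partial>M)
        = indicator {0<..} t * emeasure M {x\<in>space M. t < f x}"
      by (simp add: nn_integral_cmult)
  qed
  finally show ?thesis .
qed

text \<open>Brunn-Minkowski asks for sets of finite measure; Markov's inequality provides them at
  every positive height.\<close>

lemma integrable_superlevel_fmeasurable:
  fixes f :: "'a \<Rightarrow> real"
  assumes "integrable M f" "\<And>x. 0 \<le> f x" "0 < t"
  shows "{x\<in>space M. t < f x} \<in> fmeasurable M"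
proof (rule fmeasurableI)
  have [measurable]: "f \<in> borel_measurable M" using assms by auto
  show "{x\<in>space M. t < f x} \<in> sets M" by measurable
  have "emeasure M {x\<in>space M. t < f x} \<le> emeasure M {x\<in>space M. t \<le> f x}"
    by (intro emeasure_mono) auto
  also have "\<dots> \<le> ennreal (1 / t * integral\<^sup>L M f)"
    using assms by (intro integral_Markov_inequality) auto
  also have "\<dots> < \<infinity>" by simp
  finally show "emeasure M {x\<in>space M. t < f x} < \<infinity>" .
qed

text \<open>With both suprema equal to 1, the superlevel sets of \<open>f\<close> and
  \<open>g\<close> are nonempty at every height below 1 and both empty from 1 on. So Brunn-Minkowski
  applies at each height that counts, and integrating over the heights gives a bound by the
  arithmetic mean.\<close>

lemma prekopa_leindler_real_sup1:
  fixes f g h :: "real \<Rightarrow> real"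
  assumes int: "integrable lborel f" "integrable lborel g" "integrable lborel h"
    and nonneg: "\<And>x. 0 \<le> f x" "\<And>x. 0 \<le> g x" "\<And>x. 0 \<le> h x"
    and le1: "\<And>x. f x \<le> 1" "\<And>x. g x \<le> 1"
    and sup1: "\<And>t. t < 1 \<Longrightarrow> \<exists>x. t < f x" "\<And>t. t < 1 \<Longrightarrow> \<exists>x. t < g x"
    and l: "0 < l" "l < 1"
    and h: "\<And>t x y. 0 < t \<Longrightarrow> t < f x \<Longrightarrow> t < g y \<Longrightarrow> t < h (l * x + (1 - l) * y)"
  shows "l * integral\<^sup>L lborel f + (1 - l) * integral\<^sup>L lborel g \<le> integral\<^sup>L lborel h"
proof -
  have [measurable]: "f \<in> borel_measurable borel" "g \<in> borel_measurable borel"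
      "h \<in> borel_measurable borel"
    using int by auto
  note layer = nn_integral_layer_cake[OF lborel.sigma_finite_measure_axioms, simplified]
  let ?m = "\<lambda>f t. emeasure lborel {x::real. t < (f x :: real)}"
  have level: "ennreal l * ?m f t + ennreal (1 - l) * ?m g t \<le> ?m h t" if "0 < t" for t
  proof (cases "t < 1")
    case True
    have fin: "{x. t < f x} \<in> fmeasurable lborel" "{x. t < g x} \<in> fmeasurable lborel"
        "{x. t < h x} \<in> fmeasurable lborel"
      using int nonneg \<open>0 < t\<close> integrable_superlevel_fmeasurable[of lborel f t]
        integrable_superlevel_fmeasurable[of lborel g t]
        integrable_superlevel_fmeasurable[of lborel h t] by simp_all
    have "l * measure lborel {x. t < f x} + (1 - l) * measure lborel {x. t < g x}
        \<le> measure lborel {x. t < h x}"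
      using sup1[OF True] l h[OF \<open>0 < t\<close>] by (intro brunn_minkowski_real fin) auto
    then show ?thesis
      using fin l by (simp add: emeasure_eq_measure2 flip: ennreal_mult ennreal_plus)
  next
    case False
    then have "{x. t < f x} = {}" "{x. t < g x} = {}"
      using le1 by (auto simp: not_less intro: order_trans[of _ 1])
    then show ?thesis by simp
  qed
  have "ennreal (l * integral\<^sup>L lborel f + (1 - l) * integral\<^sup>L lborel g)
      = ennreal l * (\<integral>\<^sup>+x. ennreal (f x) \<partial>lborel) + ennreal (1 - l) * (\<integral>\<^sup>+x. ennreal (g x) \<partial>lborel)"
    using int nonneg l
    by (simp add: nn_integral_eq_integral ennreal_mult ennreal_plus integral_nonneg_AE)
  also have "\<dots> = (\<integral>\<^sup>+t. indicator {0<..} t * (ennreal l * ?m f t + ennreal (1 - l) * ?m g t) \<partial>lborel)"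
    using nonneg
    by (simp add: layer nn_integral_add nn_integral_cmult distrib_left mult.left_commute
        flip: nn_integral_cmult)
  also have "\<dots> \<le> (\<integral>\<^sup>+t. indicator {0<..} t * ?m h t \<partial>lborel)"
    using level by (intro nn_integral_mono) (auto split: split_indicator)
  also have "\<dots> = ennreal (integral\<^sup>L lborel h)"
    using int nonneg by (simp add: layer[symmetric] nn_integral_eq_integral)
  finally show ?thesis
    using nonneg by (simp add: integral_nonneg_AE)
qed

text \<open>Dividing \<open>f\<close> and \<open>g\<close> by their suprema \<open>a\<close> and
  \<open>b\<close>, and \<open>h\<close> by \<open>c\<close>, the weighted geometric mean of
  \<open>a\<close> and \<open>b\<close>, leads to the normalised case. Young's inequality passes
  from the arithmetic to the geometric mean, and \<open>c\<close> cancels by homogeneity.\<close>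

lemma prekopa_leindler_real:
  fixes f g h :: "real \<Rightarrow> real"
  assumes int: "integrable lborel f" "integrable lborel g" "integrable lborel h"
    and nonneg: "\<And>x. 0 \<le> f x" "\<And>x. 0 \<le> g x" "\<And>x. 0 \<le> h x"
    and bdd: "\<And>x. f x \<le> B" "\<And>x. g x \<le> B"
    and l: "0 < l" "l < 1"
    and h: "\<And>x y. f x powr l * g y powr (1 - l) \<le> h (l * x + (1 - l) * y)"
  shows "integral\<^sup>L lborel f powr l * integral\<^sup>L lborel g powr (1 - l) \<le> integral\<^sup>L lborel h"
proof (cases "integral\<^sup>L lborel f = 0 \<or> integral\<^sup>L lborel g = 0")
  case True
  then show ?thesis using nonneg by (auto simp: integral_nonneg_AE)
next
  case False
  define a b where "a = (SUP x. f x)" and "b = (SUP x. g x)"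
  have bddf: "bdd_above (range f)" and bddg: "bdd_above (range g)"
    using bdd by (intro bdd_aboveI2; blast)+
  have fa: "f x \<le> a" and gb: "g x \<le> b" for x
    by (auto simp: a_def b_def intro: cSUP_upper bddf bddg)
  have "a \<noteq> 0"
  proof
    assume "a = 0"
    then have "f = (\<lambda>x. 0)"
      using fa nonneg(1) by (intro ext antisym) auto
    with False show False by simp
  qed
  have "b \<noteq> 0"
  proof
    assume "b = 0"
    then have "g = (\<lambda>x. 0)"
      using gb nonneg(2) by (intro ext antisym) auto
    with False show False by simp
  qed
  have "0 < a" "0 < b"
    using \<open>a \<noteq> 0\<close> \<open>b \<noteq> 0\<close> fa[of 0] gb[of 0] nonneg(1,2)[of 0] by linarith+
  define c where "c = a powr l * b powr (1 - l)"
  have "0 < c" using \<open>0 < a\<close> \<open>0 < b\<close> by (simp add: c_def)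
  let ?F = "integral\<^sup>L lborel f" and ?G = "integral\<^sup>L lborel g"
  have FG: "0 < ?F" "0 < ?G"
    using False nonneg by (auto simp: less_le integral_nonneg_AE)
  have "l * integral\<^sup>L lborel (\<lambda>x. f x / a) + (1 - l) * integral\<^sup>L lborel (\<lambda>x. g x / b)
      \<le> integral\<^sup>L lborel (\<lambda>x. h x / c)"
  proof (rule prekopa_leindler_real_sup1)
    show "\<exists>x. t < f x / a" if "t < 1" for t
    proof -
      have "t * a < a" using that \<open>0 < a\<close> by simp
      then obtain x where "t * a < f x"
        unfolding a_def using less_cSUP_iff[OF _ bddf] by auto
      then show ?thesis using \<open>0 < a\<close> by (auto simp: pos_less_divide_eq)
    qed
    show "\<exists>x. t < g x / b" if "t < 1" for t
    proof -
      have "t * b < b" using that \<open>0 < b\<close> by simp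
      then obtain x where "t * b < g x"
        unfolding b_def using less_cSUP_iff[OF _ bddg] by auto
      then show ?thesis using \<open>0 < b\<close> by (auto simp: pos_less_divide_eq)
    qed
    fix t x y :: real assume t: "0 < t" "t < f x / a" "t < g y / b"
    \<comment> \<open>The height \<open>t\<close> is split into powers so that each factor can be
      compared with one of the two function values.\<close>
    have "t = t powr l * t powr (1 - l)"
      using \<open>0 < t\<close> by (simp flip: powr_add)
    also have "\<dots> < (f x / a) powr l * (g y / b) powr (1 - l)"
      using t l by (intro mult_strict_mono powr_less_mono2) auto
    also have "\<dots> = f x powr l * g y powr (1 - l) / c"
      using nonneg \<open>0 < a\<close> \<open>0 < b\<close> by (simp add: powr_divide c_def)
    also have "\<dots> \<le> h (l * x + (1 - l) * y) / c"
      using h \<open>0 < c\<close> by (intro divide_right_mono) auto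
    finally show "t < h (l * x + (1 - l) * y) / c" .
  qed (use int nonneg fa gb l \<open>0 < a\<close> \<open>0 < b\<close> \<open>0 < c\<close> in auto)
  then have "l * (?F / a) + (1 - l) * (?G / b) \<le> integral\<^sup>L lborel h / c" by simp
  moreover have "(?F / a) powr l * (?G / b) powr (1 - l) \<le> l * (?F / a) + (1 - l) * (?G / b)"
    using l FG \<open>0 < a\<close> \<open>0 < b\<close> by (intro Youngs_inequality_0) auto
  moreover have "(?F / a) powr l * (?G / b) powr (1 - l) = ?F powr l * ?G powr (1 - l) / c"
    using FG \<open>0 < a\<close> \<open>0 < b\<close> by (simp add: powr_divide c_def)
  ultimately have "?F powr l * ?G powr (1 - l) / c \<le> integral\<^sup>L lborel h / c" by linarith
  then show ?thesis using \<open>0 < c\<close> by (simp add: divide_le_cancel)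
qed

section \<open>Prekopa-Leindler for the normal distribution and its finite products\<close>

text \<open>The exponent is a negative quadratic; its concavity defect is exactly
  \<open>l * (1 - l) * (x - y)\<^sup>2 / 2\<close>.\<close>

lemma std_normal_density_log_concave:
  assumes l: "0 < l" "l < 1"
  shows "std_normal_density x powr l * std_normal_density y powr (1 - l)
    \<le> std_normal_density (l * x + (1 - l) * y)"
proof -
  define c :: real where "c = 1 / sqrt (2 * pi)"
  have c: "0 < c" by (simp add: c_def)
  have "std_normal_density x powr l * std_normal_density y powr (1 - l)
      = (c powr l * c powr (1 - l)) * (exp (- x\<^sup>2 / 2 * l) * exp (- y\<^sup>2 / 2 * (1 - l)))"
    using c by (simp add: std_normal_density_def powr_mult exp_powr_real flip: c_def)
  also have "\<dots> = c * exp (- x\<^sup>2 / 2 * l + - y\<^sup>2 / 2 * (1 - l))"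
    using c unfolding exp_add by (simp flip: powr_add)
  also have "- x\<^sup>2 / 2 * l + - y\<^sup>2 / 2 * (1 - l)
      = - (l * x + (1 - l) * y)\<^sup>2 / 2 - l * (1 - l) * (x - y)\<^sup>2 / 2"
    by (simp add: field_simps power2_eq_square)
  also have "c * exp (- (l * x + (1 - l) * y)\<^sup>2 / 2 - l * (1 - l) * (x - y)\<^sup>2 / 2)
      \<le> c * exp (- (l * x + (1 - l) * y)\<^sup>2 / 2)"
    using c l by simp
  finally show ?thesis
    by (simp add: std_normal_density_def c_def)
qed

text \<open>Supplies the bound \<open>B = 1\<close> when \<open>prekopa_leindler_real\<close> is
  applied to functions multiplied by the density.\<close>

lemma std_normal_density_le_1: "std_normal_density x \<le> 1"
proof -
  have "1 \<le> sqrt (2 * pi)" using pi_ge_two by simp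
  then have "1 / sqrt (2 * pi) * exp (- x\<^sup>2 / 2) \<le> 1 * 1"
    by (intro mult_mono) auto
  then show ?thesis by (simp add: std_normal_density_def)
qed

text \<open>The density is absorbed into all three functions, its log-concavity multiplying the
  hypothesis on \<open>f\<close>, \<open>g\<close> and \<open>h\<close>. Values in the unit interval
  give integrability and boundedness, and integration against a probability measure preserves them,
  which suits the induction on the dimension.\<close>

lemma prekopa_leindler_std_normal:
  fixes f g h :: "real \<Rightarrow> real"
  assumes meas [measurable]: "f \<in> borel_measurable borel" "g \<in> borel_measurable borel"
      "h \<in> borel_measurable borel"
    and range: "\<And>x. f x \<in> {0..1}" "\<And>x. g x \<in> {0..1}" "\<And>x. h x \<in> {0..1}"
    and l: "0 < l" "l < 1"
    and h: "\<And>x y. f x powr l * g y powr (1 - l) \<le> h (l * x + (1 - l) * y)"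
  shows "integral\<^sup>L std_normal_distribution f powr l * integral\<^sup>L std_normal_distribution g powr (1 - l)
    \<le> integral\<^sup>L std_normal_distribution h"
proof -
  let ?d = "std_normal_density"
  have int: "integrable lborel (\<lambda>x. ?d x * k x)"
    if [measurable]: "k \<in> borel_measurable borel" and "\<And>x. k x \<in> {0..1}" for k :: "real \<Rightarrow> real"
    using that(2)
    by (intro Bochner_Integration.integrable_bound[OF integrable_normal_density[of 1 0]])
      (auto simp: abs_mult mult_left_le)
  have eq: "integral\<^sup>L std_normal_distribution k = (\<integral>x. ?d x * k x \<partial>lborel)"
    if [measurable]: "k \<in> borel_measurable borel" for k :: "real \<Rightarrow> real"
    by (intro integral_real_density) auto
  have le: "?d x * k x \<le> 1" if "\<And>x. k x \<in> {0..1}" for k x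
    using that[of x] std_normal_density_le_1[of x] by (auto intro: mult_le_one)
  show ?thesis unfolding meas[THEN eq]
  proof (rule prekopa_leindler_real[where B = 1])
    fix x y :: real
    have "(?d x * f x) powr l * (?d y * g y) powr (1 - l)
        = (?d x powr l * ?d y powr (1 - l)) * (f x powr l * g y powr (1 - l))"
      using range by (simp add: powr_mult)
    also have "\<dots> \<le> ?d (l * x + (1 - l) * y) * h (l * x + (1 - l) * y)"
      by (intro mult_mono std_normal_density_log_concave h l) auto
    finally show "(?d x * f x) powr l * (?d y * g y) powr (1 - l)
      \<le> ?d (l * x + (1 - l) * y) * h (l * x + (1 - l) * y)" .
  qed (use meas range l le int in auto)
qed

lemma prob_space_std_normal: "prob_space std_normal_distribution"
  using real_dist_normal_dist by (simp add: real_distribution_def)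

text \<open>Integrating out one coordinate preserves the hypothesis, by the one-dimensional case.\<close>

lemma prekopa_leindler_std_normal_PiM:
  fixes f g h :: "('i \<Rightarrow> real) \<Rightarrow> real"
  assumes "finite I"
    and "f \<in> borel_measurable (Pi\<^sub>M I (\<lambda>_. std_normal_distribution))"
      "g \<in> borel_measurable (Pi\<^sub>M I (\<lambda>_. std_normal_distribution))"
      "h \<in> borel_measurable (Pi\<^sub>M I (\<lambda>_. std_normal_distribution))"
    and "\<And>x. f x \<in> {0..1}" "\<And>x. g x \<in> {0..1}" "\<And>x. h x \<in> {0..1}"
    and l: "0 < l" "l < 1"
    and "\<And>x y. x \<in> extensional I \<Longrightarrow> y \<in> extensional I \<Longrightarrow>
        f x powr l * g y powr (1 - l) \<le> h (\<lambda>i\<in>I. l * x i + (1 - l) * y i)"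
  shows "integral\<^sup>L (Pi\<^sub>M I (\<lambda>_. std_normal_distribution)) f powr l
      * integral\<^sup>L (Pi\<^sub>M I (\<lambda>_. std_normal_distribution)) g powr (1 - l)
    \<le> integral\<^sup>L (Pi\<^sub>M I (\<lambda>_. std_normal_distribution)) h"
  using assms(1-7,10)
proof (induction I arbitrary: f g h rule: finite_induct)
  case empty
  show ?case
    \<comment> \<open>The product over the empty index set is the point mass at the everywhere
      undefined function.\<close>
    using empty.prems(7)[of "\<lambda>_. undefined" "\<lambda>_. undefined"]
    by (simp add: PiM_empty lebesgue_integral_count_space_finite restrict_def)
next
  case (insert k I)
  note [measurable] = insert.prems(1-3)
  let ?N = "std_normal_distribution"
  interpret N: prob_space ?N by (rule prob_space_std_normal)
  interpret product_sigma_finite "\<lambda>_::'i. ?N" ..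
  interpret P: prob_space "Pi\<^sub>M (insert k I) (\<lambda>_::'i. ?N)"
    by (intro prob_space_PiM prob_space_std_normal)
  \<comment> \<open>Measurability of \<open>q\<close> constrains it on extensional functions only,
    so slices are measurable for extensional \<open>x\<close>. This is why the hypothesis of the
    induction is restricted to such points.\<close>
  have slice: "(\<lambda>s. q (x(k := s))) \<in> borel_measurable borel"
    if "x \<in> extensional I" "q \<in> borel_measurable (Pi\<^sub>M (insert k I) (\<lambda>_. ?N))"
    for x and q :: "('i \<Rightarrow> real) \<Rightarrow> real"
    using measurable_component_update[of x I "\<lambda>_. ?N" k, THEN measurable_compose, OF _ _ that(2)]
      that(1) insert.hyps(2)
    by (simp add: space_PiM PiE_def cong: measurable_cong_sets)
  let ?J = "\<lambda>f x. integral\<^sup>L ?N (\<lambda>s. f (x(k := s)))"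
  have eq: "integral\<^sup>L (Pi\<^sub>M (insert k I) (\<lambda>_. ?N)) q = integral\<^sup>L (Pi\<^sub>M I (\<lambda>_. ?N)) (?J q)"
    if [measurable]: "q \<in> borel_measurable (Pi\<^sub>M (insert k I) (\<lambda>_. ?N))"
      and "\<And>x. q x \<in> {0..1}" for q :: "('i \<Rightarrow> real) \<Rightarrow> real"
  proof (rule product_integral_insert[OF insert.hyps])
    show "integrable (Pi\<^sub>M (insert k I) (\<lambda>_. ?N)) q"
      using that(2) by (intro P.integrable_const_bound[of _ 1]) auto
  qed
  have meas: "?J q \<in> borel_measurable (Pi\<^sub>M I (\<lambda>_. ?N))"
    if [measurable]: "q \<in> borel_measurable (Pi\<^sub>M (insert k I) (\<lambda>_. ?N))"
    for q :: "('i \<Rightarrow> real) \<Rightarrow> real"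
    using measurable_compose[OF measurable_add_dim that]
    by (intro N.borel_measurable_lebesgue_integral) (simp add: split_beta')
  \<comment> \<open>This holds at every \<open>x\<close>: where the slice is not integrable, its
    integral is 0 by default.\<close>
  have range: "?J q x \<in> {0..1}" if "\<And>x. q x \<in> {0..1}" for q :: "('i \<Rightarrow> real) \<Rightarrow> real" and x
  proof (cases "integrable ?N (\<lambda>s. q (x(k := s)))")
    case True
    then show ?thesis
      using that by (auto intro: N.integral_le_const integral_nonneg_AE)
  qed (simp add: not_integrable_integral_eq)
  show ?case
    unfolding eq[OF insert.prems(1,4)] eq[OF insert.prems(2,5)] eq[OF insert.prems(3,6)]
  proof (rule insert.IH)
    fix x y :: "'i \<Rightarrow> real" assume x: "x \<in> extensional I" and y: "y \<in> extensional I"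
    show "?J f x powr l * ?J g y powr (1 - l) \<le> ?J h (\<lambda>i\<in>I. l * x i + (1 - l) * y i)"
    proof (rule prekopa_leindler_std_normal[OF _ _ _ _ _ _ l])
      fix s t :: real
      have "(\<lambda>i\<in>I. l * x i + (1 - l) * y i)(k := l * s + (1 - l) * t)
          = (\<lambda>i\<in>insert k I. l * (x(k := s)) i + (1 - l) * (y(k := t)) i)"
        using insert.hyps(2) by auto
      moreover have "x(k := s) \<in> extensional (insert k I)" "y(k := t) \<in> extensional (insert k I)"
        using x y by (auto simp: extensional_def)
      ultimately show "f (x(k := s)) powr l * g (y(k := t)) powr (1 - l)
          \<le> h ((\<lambda>i\<in>I. l * x i + (1 - l) * y i)(k := l * s + (1 - l) * t))"
        using insert.prems(7) by presburger
    qed (use insert.prems(1-6) x y in \<open>auto intro!: slice\<close>)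
  qed (intro meas range insert.prems)+
qed

section \<open>The standard Gaussian law on vectors and its null sets\<close>

text \<open>A reference law free of mean and covariance: every \<open>gaussian_measure\<close> is an
  affine image of it, and it stays absolutely continuous where the image for a singular \<Sigma>
  does not.\<close>

definition std_gaussian :: "(real^'m) measure" where
  "std_gaussian = distr (Pi\<^sub>M UNIV (\<lambda>_::'m. std_normal_distribution)) borel vec_lambda"

lemma measurable_vec_lambda_std_normal [measurable]:
  "vec_lambda \<in> borel_measurable (Pi\<^sub>M UNIV (\<lambda>_::'m::finite. std_normal_distribution))"
  using measurable_gaussian_map[of "0 :: real^'m" "mat 1"] by simp

lemma measurable_vec_lambda_lborel [measurable]:
  "vec_lambda \<in> borel_measurable (Pi\<^sub>M UNIV (\<lambda>_::'m::finite. lborel :: real measure))"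
proof -
  have "sets (Pi\<^sub>M UNIV (\<lambda>_::'m. lborel :: real measure))
      = sets (Pi\<^sub>M UNIV (\<lambda>_::'m. std_normal_distribution))"
    by (intro sets_PiM_cong) auto
  from measurable_cong_sets[OF this refl] show ?thesis
    using measurable_vec_lambda_std_normal by blast
qed

lemma sets_std_gaussian [simp, measurable_cong]: "sets std_gaussian = sets borel"
  by (simp add: std_gaussian_def)

lemma space_std_gaussian [simp]: "space std_gaussian = UNIV"
  by (simp add: std_gaussian_def)

lemma prob_space_std_gaussian: "prob_space std_gaussian"
  unfolding std_gaussian_def
  by (intro prob_space.prob_space_distr prob_space_std_normal_PiM measurable_vec_lambda_std_normal)

text \<open>The chosen root depends on \<Sigma> alone, so one \<open>A\<close> serves all means.
  Gaussian laws with different means can then be compared under a single measure.\<close>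

lemma gaussian_measure_eq_distr:
  obtains A :: "real^'m^'m"
  where "\<And>\<mu>. gaussian_measure \<mu> \<Sigma> = distr std_gaussian borel (\<lambda>z. \<mu> + A *v z)"
proof
  fix \<mu> :: "real^'m"
  let ?A = "SOME A :: real^'m^'m. A ** transpose A = \<Sigma>"
  have "(\<lambda>z. \<mu> + ?A *v z) \<in> borel_measurable borel"
    by (intro borel_measurable_continuous_onI continuous_intros
        matrix_vector_mult_linear_continuous_on)
  then show "gaussian_measure \<mu> \<Sigma> = distr std_gaussian borel (\<lambda>z. \<mu> + ?A *v z)"
    unfolding gaussian_measure_def std_gaussian_def
    by (subst distr_distr) (auto simp: comp_def)
qed

text \<open>This is Prekopa-Leindler for indicator functions. Off \<open>U\<close> or
  \<open>V\<close> the left factor product is 0, since \<open>0 powr l = 0\<close>; on them the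
  inclusion puts the combination into \<open>W\<close>.\<close>

lemma measure_std_gaussian_powr_le:
  fixes U V W :: "(real^'m) set"
  assumes [measurable]: "U \<in> sets borel" "V \<in> sets borel" "W \<in> sets borel"
    and l: "0 < l" "l < 1"
    and sub: "\<And>u v. u \<in> U \<Longrightarrow> v \<in> V \<Longrightarrow> l *\<^sub>R u + (1 - l) *\<^sub>R v \<in> W"
  shows "measure std_gaussian U powr l * measure std_gaussian V powr (1 - l)
    \<le> measure std_gaussian W"
proof -
  let ?P = "Pi\<^sub>M UNIV (\<lambda>_::'m. std_normal_distribution)"
  let ?i = "\<lambda>U \<omega>. indicator U (vec_lambda \<omega> :: real^'m) :: real"
  have eq: "measure std_gaussian U = integral\<^sup>L ?P (?i U)"
    if [measurable]: "U \<in> sets borel" for U :: "(real^'m) set"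
  proof -
    have "measure std_gaussian U = integral\<^sup>L std_gaussian (indicator U)" by simp
    also have "\<dots> = integral\<^sup>L ?P (?i U)"
      unfolding std_gaussian_def by (rule integral_distr) measurable
    finally show ?thesis .
  qed
  show ?thesis
    unfolding eq[OF assms(1)] eq[OF assms(2)] eq[OF assms(3)]
  proof (rule prekopa_leindler_std_normal_PiM[OF _ _ _ _ _ _ _ l])
    fix x y :: "'m \<Rightarrow> real"
    have "l *\<^sub>R vec_lambda x + (1 - l) *\<^sub>R vec_lambda y
        = (vec_lambda (\<lambda>i\<in>UNIV. l * x i + (1 - l) * y i) :: real^'m)"
      by (simp add: vec_eq_iff)
    with sub[of "vec_lambda x" "vec_lambda y"]
    show "?i U x powr l * ?i V y powr (1 - l) \<le> ?i W (\<lambda>i\<in>UNIV. l * x i + (1 - l) * y i)"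
      by (auto split: split_indicator)
  qed (auto split: split_indicator)
qed

text \<open>\<open>lborel\<close> is determined by its values on boxes, and a box pulls back to a
  product of intervals.\<close>

lemma distr_PiM_lborel_vec_lambda:
  "distr (Pi\<^sub>M UNIV (\<lambda>_::'m. lborel)) borel vec_lambda = (lborel :: (real^'m) measure)"
proof (rule lborel_eqI[symmetric])
  fix a b :: "real^'m" assume le: "\<And>e. e \<in> Basis \<Longrightarrow> a \<bullet> e \<le> b \<bullet> e"
  interpret product_sigma_finite "\<lambda>_::'m. lborel :: real measure" ..
  have le': "a $ i \<le> b $ i" for i
    using le[of "axis i 1"] by (simp add: inner_axis)
  have Basis: "(Basis :: (real^'m) set) = range (\<lambda>i. axis i 1)"
    by (auto simp: Basis_vec_def)
  have "vec_lambda -` box a b \<inter> space (Pi\<^sub>M UNIV (\<lambda>_::'m. lborel))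
      = Pi\<^sub>E UNIV (\<lambda>i. {a $ i <..< b $ i})"
    by (auto simp: space_PiM mem_box_cart PiE_def Pi_def)
  then have "emeasure (distr (Pi\<^sub>M UNIV (\<lambda>_::'m. lborel)) borel vec_lambda) (box a b)
      = emeasure (Pi\<^sub>M UNIV (\<lambda>_::'m. lborel)) (Pi\<^sub>E UNIV (\<lambda>i. {a $ i <..< b $ i}))"
    by (simp add: emeasure_distr)
  also have "\<dots> = (\<Prod>i\<in>UNIV. ennreal (b $ i - a $ i))"
    using le' by (subst emeasure_PiM) auto
  also have "\<dots> = ennreal (\<Prod>i\<in>UNIV. b $ i - a $ i)"
    using le' by (subst prod_ennreal) auto
  also have "(\<Prod>i\<in>UNIV. b $ i - a $ i) = (\<Prod>e\<in>Basis. (b - a) \<bullet> e)"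
    unfolding Basis by (subst prod.reindex) (auto simp: inj_on_def axis_eq_axis inner_axis)
  finally show "emeasure (distr (Pi\<^sub>M UNIV (\<lambda>_::'m. lborel)) borel vec_lambda) (box a b)
      = ennreal (\<Prod>e\<in>Basis. (b - a) \<bullet> e)" .
qed simp

text \<open>A product measure is determined on measurable rectangles, where the integral of the
  product density factors.\<close>

lemma PiM_std_normal_eq_density:
  "Pi\<^sub>M UNIV (\<lambda>_::'m::finite. std_normal_distribution)
    = density (Pi\<^sub>M UNIV (\<lambda>_. lborel)) (\<lambda>\<omega>. \<Prod>i\<in>UNIV. ennreal (std_normal_density (\<omega> i)))"
proof -
  interpret L: product_sigma_finite "\<lambda>_::'m. lborel :: real measure" ..
  interpret N: prob_space std_normal_distribution by (rule prob_space_std_normal)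
  interpret product_sigma_finite "\<lambda>_::'m. std_normal_distribution" ..
  let ?D = "density (Pi\<^sub>M UNIV (\<lambda>_::'m. lborel))
      (\<lambda>\<omega>. \<Prod>i\<in>UNIV. ennreal (std_normal_density (\<omega> i)))"
  have "?D = Pi\<^sub>M UNIV (\<lambda>_::'m. std_normal_distribution)"
  proof (rule PiM_eqI)
    show "sets ?D = sets (Pi\<^sub>M UNIV (\<lambda>_::'m. std_normal_distribution))"
      by (simp, intro sets_PiM_cong) auto
    fix A :: "'m \<Rightarrow> real set"
    assume "\<And>i. i \<in> UNIV \<Longrightarrow> A i \<in> sets std_normal_distribution"
    then have [measurable]: "A i \<in> sets borel" for i by simp
    have [measurable]: "Pi\<^sub>E UNIV A \<in> sets (Pi\<^sub>M UNIV (\<lambda>_::'m. lborel))"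
      by (intro sets_PiM_I_finite) auto
    have ind: "indicator (Pi\<^sub>E UNIV A) \<omega> = (\<Prod>i\<in>UNIV. indicator (A i) (\<omega> i) :: ennreal)" for \<omega>
      by (auto simp: indicator_def PiE_def Pi_def prod_zero_iff)
    have "emeasure ?D (Pi\<^sub>E UNIV A) = (\<integral>\<^sup>+\<omega>. (\<Prod>i\<in>UNIV. ennreal (std_normal_density (\<omega> i)) *
        indicator (A i) (\<omega> i)) \<partial>Pi\<^sub>M UNIV (\<lambda>_::'m. lborel))"
      by (subst emeasure_density) (auto simp: ind prod.distrib)
    also have "\<dots> = (\<Prod>i\<in>UNIV. \<integral>\<^sup>+x. ennreal (std_normal_density x) * indicator (A i) x \<partial>lborel)"
      by (rule L.product_nn_integral_prod) auto
    also have "\<dots> = (\<Prod>i\<in>UNIV. emeasure std_normal_distribution (A i))"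
      by (intro prod.cong refl) (simp add: emeasure_density)
    finally show "emeasure ?D (Pi\<^sub>E UNIV A) = (\<Prod>i\<in>UNIV. emeasure std_normal_distribution (A i))" .
  qed simp
  then show ?thesis ..
qed

text \<open>Both measures are images under \<open>vec_lambda\<close> of product measures, and the
  normal product has a density with respect to the Lebesgue product; so a Lebesgue null set has a
  preimage that is null for both.\<close>

lemma absolutely_continuous_std_gaussian: "absolutely_continuous lborel (std_gaussian :: (real^'m) measure)"
  unfolding absolutely_continuous_def
proof
  fix E :: "(real^'m) set" assume "E \<in> null_sets lborel"
  then have [measurable]: "E \<in> sets borel"
    and 0: "emeasure (distr (Pi\<^sub>M UNIV (\<lambda>_::'m. lborel)) borel vec_lambda) E = 0"
    by (auto simp: distr_PiM_lborel_vec_lambda)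
  let ?E = "vec_lambda -` E \<inter> space (Pi\<^sub>M UNIV (\<lambda>_::'m. lborel :: real measure))"
  have "?E \<in> null_sets (Pi\<^sub>M UNIV (\<lambda>_::'m. lborel))"
    using 0 by (auto simp: emeasure_distr)
  then have "?E \<in> null_sets (Pi\<^sub>M UNIV (\<lambda>_::'m. std_normal_distribution))"
    unfolding PiM_std_normal_eq_density
    by (intro absolutely_continuousI_density[unfolded absolutely_continuous_def, THEN subsetD]) auto
  then show "E \<in> null_sets std_gaussian"
    by (auto simp: std_gaussian_def emeasure_distr null_sets_def space_PiM)
qed

text \<open>Interior and closure are Borel even when \<open>T\<close> is not, so either can stand in
  for \<open>T\<close>.\<close>

lemma measure_std_gaussian_closure_convex:
  fixes T :: "(real^'m) set"
  assumes "convex T"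
  shows "measure std_gaussian (closure T) = measure std_gaussian (interior T)"
proof -
  have "frontier T \<in> null_sets lborel"
    using negligible_convex_frontier[OF assms]
    by (simp add: negligible_iff_null_sets null_sets_completion_iff)
  then have "frontier T \<in> null_sets std_gaussian"
    using absolutely_continuous_std_gaussian by (auto simp: absolutely_continuous_def)
  moreover have "closure T = interior T \<union> frontier T"
    using interior_subset[of T] closure_subset[of T] by (auto simp: frontier_def)
  ultimately show ?thesis
    by (simp add: measure_Un_null_set)
qed

section \<open>Convex sets under possibly singular Gaussian laws, and log-concavity\<close>

lemma convex_affine_vimage:
  fixes A :: "real^'n^'m"
  assumes "convex S"
  shows "convex ((\<lambda>z. c + A *v z) -` S)"
proof (rule convexI)
  fix x y and u v :: real
  assume xy: "x \<in> (\<lambda>z. c + A *v z) -` S" "y \<in> (\<lambda>z. c + A *v z) -` S"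
    and uv: "0 \<le> u" "0 \<le> v" "u + v = 1"
  have "u *\<^sub>R (c + A *v x) + v *\<^sub>R (c + A *v y) \<in> S"
    using xy uv by (intro convexD[OF assms]) auto
  also have "u *\<^sub>R (c + A *v x) + v *\<^sub>R (c + A *v y)
      = (u + v) *\<^sub>R c + A *v (u *\<^sub>R x + v *\<^sub>R y)"
    by (simp add: matrix_vector_right_distrib matrix_vector_mult_scaleR algebra_simps)
  finally show "u *\<^sub>R x + v *\<^sub>R y \<in> (\<lambda>z. c + A *v z) -` S"
    using uv by simp
qed

text \<open>The image of the interior of \<open>T = g -` S\<close> and the image of its closure together with the
  complement of \<open>range g\<close> are \<open>F\<^sub>\<sigma>\<close>-sets enclosing \<open>S\<close>, even if \<open>g\<close> is singular.\<close>

lemma convex_sets_completion_affine_gaussian: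
  fixes S :: "(real^'m) set" and A :: "real^'m^'m" and \<mu> :: "real^'m"
  assumes "convex S"
  defines "g \<equiv> \<lambda>z. \<mu> + A *v z"
  defines "M \<equiv> distr std_gaussian borel g"
  shows "S \<in> sets (completion M)"
    and "measure (completion M) S = measure std_gaussian (closure (g -` S))"
proof -
  interpret G: prob_space "std_gaussian :: (real^'m) measure" by (rule prob_space_std_gaussian)
  have contg: "continuous_on X g" for X
    unfolding g_def by (intro continuous_intros matrix_vector_mult_linear_continuous_on)
  have [measurable]: "g \<in> borel_measurable borel"
    by (intro borel_measurable_continuous_onI contg)
  interpret M: prob_space M
    unfolding M_def by (intro G.prob_space_distr) simp
  interpret C: prob_space "completion M" by (rule M.prob_space_completion)
  define T where "T = g -` S"
  have gsum: "g (x + k) = g x + A *v k" for x k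
    by (simp add: g_def matrix_vector_right_distrib)
  have convT: "convex T"
    unfolding T_def g_def by (rule convex_affine_vimage[OF assms(1)])
  have image_compact: "compact (g ` K)" if "compact K" for K
    using that by (intro compact_continuous_image contg)
  \<comment> \<open>The affine image of a closed set need not be closed, but it is a countable union
    of compact images. The same device works for open sets below.\<close>
  have image_closed: "g ` X \<in> sets borel" if "closed X" for X
  proof -
    have "X = (\<Union>n::nat. X \<inter> cball 0 (real n))"
      by (auto simp: real_arch_simple)
    then have "g ` X = (\<Union>n::nat. g ` (X \<inter> cball 0 (real n)))"
      by (metis image_UN)
    moreover have "(\<Union>n::nat. g ` (X \<inter> cball 0 (real n))) \<in> sets borel"
      using that
      by (intro sets.countable_nat_UN image_subsetI borel_compact image_compact closed_Int_compact) auto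
    ultimately show ?thesis by simp
  qed
  have image_open: "g ` X \<in> sets borel" if X: "open X" for X
  proof -
    obtain K :: "nat \<Rightarrow> (real^'m) set" where K: "\<And>n. compact (K n)" "\<Union>(range K) = X"
      using open_Union_compact_subsets[OF X] by metis
    then have "g ` X = (\<Union>n. g ` K n)" by auto
    moreover have "(\<Union>n. g ` K n) \<in> sets borel"
      using K(1) by (intro sets.countable_nat_UN image_subsetI borel_compact image_compact) auto
    ultimately show ?thesis by simp
  qed
  define L where "L = g ` interior T"
  \<comment> \<open>Points of \<open>S\<close> outside the range of \<open>g\<close> are invisible
    to \<open>T\<close>. The complement of the range covers them and has no mass under
    \<open>M\<close>.\<close>
  define U where "U = g ` closure T \<union> - range g"
  have [measurable]: "L \<in> sets borel" "U \<in> sets borel"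
    using image_open image_closed by (auto simp: L_def U_def)
  have LS: "L \<subseteq> S" and SU: "S \<subseteq> U"
    using interior_subset[of T] closure_subset[of T] by (auto simp: L_def U_def T_def)
  have "measure M U = measure std_gaussian (closure T)"
  proof -
    have "g -` U = closure T"
    proof
      show "g -` U \<subseteq> closure T"
      proof
        fix z assume "z \<in> g -` U"
        then obtain w where w: "w \<in> closure T" "g z = g w"
          by (auto simp: U_def)
        have "A *v (z - w) = 0"
          using w(2) gsum[of w "z - w"] by simp
        \<comment> \<open>As a full preimage under \<open>g\<close>, the set \<open>T\<close> is
          invariant under translation by the kernel of \<open>A\<close>, and closure inherits this.
          Hence the image of \<open>closure T\<close> pulls back to \<open>closure T\<close>
          itself.\<close>
        then have "(+) (z - w) ` T \<subseteq> T"
          using gsum[of _ "z - w"] by (auto simp: T_def add.commute)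
        then have "(+) (z - w) ` closure T \<subseteq> closure T"
          by (metis closure_mono closure_translation)
        with w(1) have "z - w + w \<in> closure T" by blast
        then show "z \<in> closure T" by simp
      qed
    qed (auto simp: U_def)
    then show ?thesis by (simp add: M_def measure_distr)
  qed
  moreover have "measure std_gaussian (interior T) \<le> measure M L"
  proof -
    have "g -` L \<in> sets borel"
      using measurable_sets[of g borel borel L] by simp
    then have "measure std_gaussian (interior T) \<le> measure std_gaussian (g -` L)"
      by (intro G.finite_measure_mono) (auto simp: L_def)
    then show ?thesis by (simp add: M_def measure_distr)
  qed
  moreover have "measure M L \<le> measure M U"
    using LS SU by (intro M.finite_measure_mono) (auto simp: M_def)
  \<comment> \<open>The chain interior, \<open>L\<close>, \<open>U\<close>, closure has equal ends,
    so all four measures coincide and \<open>S\<close> is squeezed between sets of equal finite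
    measure.\<close>
  ultimately have eq: "measure M L = measure std_gaussian (closure T)"
      "measure M U = measure std_gaussian (closure T)"
    using measure_std_gaussian_closure_convex[OF convT] by auto
  have sets: "L \<in> sets M" "U \<in> sets M" by (simp_all add: M_def)
  have setsC: "L \<in> sets (completion M)" "U \<in> sets (completion M)"
    using sets by simp_all
  have eqC: "measure (completion M) L = measure std_gaussian (closure T)"
      "measure (completion M) U = measure std_gaussian (closure T)"
    using sets eq by simp_all
  show S: "S \<in> sets (completion M)"
  proof (rule completion.complete_sets_sandwich[OF setsC LS SU])
    show "emeasure (completion M) L = emeasure (completion M) U"
      unfolding C.emeasure_eq_measure eqC ..
    show "emeasure (completion M) L < \<infinity>"
      unfolding C.emeasure_eq_measure by simp
  qed
  show "measure (completion M) S = measure std_gaussian (closure (g -` S))"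
    using C.finite_measure_mono[OF LS S] C.finite_measure_mono[OF SU setsC(2)]
    unfolding eqC T_def by (rule antisym[rotated])
qed

theorem lemma5p2:
  fixes \<Sigma> :: "real^'m^'m"
    and f :: "real^'n \<Rightarrow> real^'m"
    and S :: "real^'n \<Rightarrow> (real^'m) set"
    and h :: "real^'n \<Rightarrow> real"
  assumes "covariance_matrix \<Sigma>"
    and "affine_fun f"
    and "\<And>x. convex (S x)"
    and "linear_on_parameter S"
    and "\<And>x. h x = (LINT z:S x|completion (gaussian_measure (f x) \<Sigma>). 1)"
  shows "log_concave_fun h"
proof -
  obtain A :: "real^'m^'m"
    where A: "\<And>\<mu>. gaussian_measure \<mu> \<Sigma> = distr std_gaussian borel (\<lambda>z. \<mu> + A *v z)"
    using gaussian_measure_eq_distr[of \<Sigma>] by blast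
  define T where "T x = (\<lambda>z. f x + A *v z) -` S x" for x
  \<comment> \<open>The dependence on \<open>x\<close> moves from the measure into the set, so that
    all values of \<open>h\<close> refer to one law.\<close>
  have h: "h x = measure std_gaussian (closure (T x))" for x
  proof -
    interpret M: prob_space "completion (gaussian_measure (f x) \<Sigma>)"
      by (intro prob_space.prob_space_completion prob_space_gaussian_measure)
    have space: "space (gaussian_measure (f x) \<Sigma>) = UNIV"
      by (simp add: A)
    show ?thesis
      using convex_sets_completion_affine_gaussian[OF assms(3)[of x], where A = A and \<mu> = "f x"]
      by (simp add: assms(5) set_lebesgue_integral_def T_def space flip: A)
  qed
  obtain F b where F: "\<And>x. f x = F *v x + b"
    using assms(2) unfolding affine_fun_def by blast
  obtain S' G where S': "\<And>x. S x = S' + {G *v x}"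
    using assms(4) unfolding linear_on_parameter_def by blast
  have mem_S: "z \<in> S x \<longleftrightarrow> z - G *v x \<in> S'" for z x
    unfolding S' set_plus_def by (auto intro!: bexI[of _ "z - G *v x"])
  \<comment> \<open>At parameter 0 the translation vanishes, so \<open>S 0\<close> is
    \<open>S'\<close>.\<close>
  have "convex S'"
    using assms(3)[of 0] by (simp add: S' set_plus_def)
  have convT: "convex (T x)" for x
    unfolding T_def by (rule convex_affine_vimage[OF assms(3)])
  \<comment> \<open>Membership of \<open>u\<close> in \<open>T x\<close> says that
    \<open>f x + A *v u - G *v x\<close> lies in the fixed convex set \<open>S'\<close>. That
    expression is affine jointly in \<open>x\<close> and \<open>u\<close>, so it commutes with
    convex combinations.\<close>
  have T: "l *\<^sub>R u + (1 - l) *\<^sub>R v \<in> T (l *\<^sub>R x + (1 - l) *\<^sub>R y)"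
    if "u \<in> T x" "v \<in> T y" "0 < l" "l < 1" for l u v x y
  proof -
    have "l *\<^sub>R (f x + A *v u - G *v x) + (1 - l) *\<^sub>R (f y + A *v v - G *v y) \<in> S'"
      using that by (intro convexD[OF \<open>convex S'\<close>]) (auto simp: T_def mem_S)
    also have "l *\<^sub>R (f x + A *v u - G *v x) + (1 - l) *\<^sub>R (f y + A *v v - G *v y)
        = f (l *\<^sub>R x + (1 - l) *\<^sub>R y) + A *v (l *\<^sub>R u + (1 - l) *\<^sub>R v)
          - G *v (l *\<^sub>R x + (1 - l) *\<^sub>R y)"
      by (simp add: F matrix_vector_right_distrib matrix_vector_mult_scaleR algebra_simps)
    finally show ?thesis
      by (simp add: T_def mem_S)
  qed
  show ?thesis
    unfolding log_concave_fun_def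
  proof (intro conjI allI ballI)
    show "0 \<le> h x" for x by (simp add: h)
    fix x y and l :: real assume "l \<in> {0<..<1}"
    then have l: "0 < l" "l < 1" by auto
    \<comment> \<open>Interiors at \<open>x\<close> and \<open>y\<close> and the closure at the
      combination are Borel, and the inclusion for \<open>T\<close> passes to them because the first
      two shrink and the last grows.\<close>
    have hi: "h z = measure std_gaussian (interior (T z))" for z
      by (simp add: h measure_std_gaussian_closure_convex[OF convT])
    show "h (l *\<^sub>R x + (1 - l) *\<^sub>R y) \<ge> h x powr l * h y powr (1 - l)"
      unfolding hi[of x] hi[of y] h[of "l *\<^sub>R x + (1 - l) *\<^sub>R y"]
    proof (rule measure_std_gaussian_powr_le[OF _ _ _ l])
      fix u v assume "u \<in> interior (T x)" "v \<in> interior (T y)"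
      then have "u \<in> T x" "v \<in> T y"
        using interior_subset by blast+
      from T[OF this l] show "l *\<^sub>R u + (1 - l) *\<^sub>R v \<in> closure (T (l *\<^sub>R x + (1 - l) *\<^sub>R y))"
        using closure_subset by blast
    qed auto
  qed
qed

end
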